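(* Let $G_1$ and $G_2$ be graphs on $n_1\ge1$ and $n_2\ge1$ vertices, respectively. Then $$BH(G_1\vee G_2)= (n_1+n_2)\left(\frac{1}{(n_1+n_2)^2}+\sum_{i=2}^{n_1}\frac{1}{(\lambda_i(G_1)+n_2)^2}+\sum_{j=2}^{n_2}\frac{1}{(\lambda_j(G_2)+n_1)^2}\right).$$
   Context: For a graph $H$ on $k$ vertices, $L(H)=D(H)-A(H)$ is its Laplacian matrix with eigenvalues $0=\lambda_1(H)\le\cdots\le\lambda_k(H)$. The biharmonic index of a connected graph $H$ on $k$ vertices is $BH(H)=\frac12\sum_{u,v}d_B^2(u,v)$ ($d_B^2$ the squared biharmonic distance), equivalently $BH(H)=k\sum_{i=2}^k\lambda_i(H)^{-2}$. The join $G_1\vee G_2$ is obtained from the disjoint union of $G_1$ and $G_2$ by adding all edges between $V(G_1)$ and $V(G_2)$. *)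

theory Defs
  imports "HOL-Analysis.Analysis" "HOL-Computational_Algebra.Polynomial"
begin

text \<open>A finite simple graph is given by its adjacency relation; its vertex set is the whole
  (nonempty, finite) type \<open>'a\<close>, so that it has \<open>CARD('a)\<close> vertices.\<close>

definition simple_graph :: "('a \<Rightarrow> 'a \<Rightarrow> bool) \<Rightarrow> bool" where
  "simple_graph E \<longleftrightarrow> symp E \<and> irreflp E"

fun graph_join :: "('a \<Rightarrow> 'a \<Rightarrow> bool) \<Rightarrow> ('b \<Rightarrow> 'b \<Rightarrow> bool) \<Rightarrow> 'a + 'b \<Rightarrow> 'a + 'b \<Rightarrow> bool" where
  "graph_join E1 E2 (Inl u) (Inl v) \<longleftrightarrow> E1 u v"
| "graph_join E1 E2 (Inr u) (Inr v) \<longleftrightarrow> E2 u v"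
| "graph_join E1 E2 (Inl u) (Inr v) \<longleftrightarrow> True"
| "graph_join E1 E2 (Inr u) (Inl v) \<longleftrightarrow> True"

definition adjacency_matrix :: "('a::finite \<Rightarrow> 'a \<Rightarrow> bool) \<Rightarrow> real^'a^'a" where
  "adjacency_matrix E = (\<chi> u v. of_bool (E u v))"

definition degree_matrix :: "('a::finite \<Rightarrow> 'a \<Rightarrow> bool) \<Rightarrow> real^'a^'a" where
  "degree_matrix E = (\<chi> u v. if u = v then real (card {w. E u w}) else 0)"

definition laplacian :: "('a::finite \<Rightarrow> 'a \<Rightarrow> bool) \<Rightarrow> real^'a^'a" where
  "laplacian E = degree_matrix E - adjacency_matrix E"

definition characteristic_poly :: "real^'n^'n \<Rightarrow> real poly" where
  "characteristic_poly A = det (\<chi> i j. (if i = j then [:0, 1:] else 0) - [:A $ i $ j:])"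

text \<open>The \<open>i\<close>-th smallest eigenvalue of the Laplacian, counted with multiplicity, where \<open>i\<close> runs
  from \<open>1\<close> to \<open>CARD('a)\<close>. The list has exactly \<open>CARD('a)\<close> entries for a simple graph, because
  the characteristic polynomial of a real symmetric matrix splits over the reals.\<close>

definition laplacian_eigenvalue :: "('a::finite \<Rightarrow> 'a \<Rightarrow> bool) \<Rightarrow> nat \<Rightarrow> real" where
  "laplacian_eigenvalue E i =
     sorted_list_of_multiset (proots (characteristic_poly (laplacian E))) ! (i - 1)"

text \<open>The Moore--Penrose inverse, characterized by the four Penrose equations.\<close>

definition pseudoinverse :: "real^'n^'m \<Rightarrow> real^'m^'n" where
  "pseudoinverse A = (THE X. A ** X ** A = A \<and> X ** A ** X = X \<and>
     transpose (A ** X) = A ** X \<and> transpose (X ** A) = X ** A)"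

text \<open>With \<open>M\<close> the square of the pseudoinverse of the Laplacian, the squared biharmonic distance
  of \<open>u\<close> and \<open>v\<close> is \<open>(e\<^sub>u - e\<^sub>v)\<^sup>T M (e\<^sub>u - e\<^sub>v)\<close>. It is only meaningful
  for connected graphs.\<close>

definition biharmonic_dist_sq :: "('a::finite \<Rightarrow> 'a \<Rightarrow> bool) \<Rightarrow> 'a \<Rightarrow> 'a \<Rightarrow> real" where
  "biharmonic_dist_sq E u v =
     (let M = pseudoinverse (laplacian E) ** pseudoinverse (laplacian E)
      in M $ u $ u + M $ v $ v - 2 * M $ u $ v)"

text \<open>The sum ranges over ordered pairs of vertices.\<close>

definition biharmonic_index :: "('a::finite \<Rightarrow> 'a \<Rightarrow> bool) \<Rightarrow> real" where
  "biharmonic_index E = 1/2 * (\<Sum>u\<in>UNIV. \<Sum>v\<in>UNIV. biharmonic_dist_sq E u v)"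

end

theory Submission
  imports Defs
begin

text \<open>If \<open>e\<^sub>i\<close> is an orthonormal eigenbasis of a Laplacian with eigenvalues \<open>\<mu>\<^sub>i\<close>, and \<open>e\<^sub>k\<close> is the
  constant vector, then \<open>L\<^sup>+\<close> is \<open>\<Sum>\<^sub>i \<mu>\<^sub>i\<inverse> e\<^sub>i e\<^sub>i\<^sup>T\<close> with the convention \<open>0\<inverse> = 0\<close>, and it annihilates
  the constants; hence the biharmonic index is \<open>n \<Sum>\<^sub>i\<^sub>\<noteq>\<^sub>k \<mu>\<^sub>i\<inverse>\<^sup>2\<close>. For the join,
  an eigenvector of one factor that is orthogonal to the constants, extended by zero, is an
  eigenvector whose eigenvalue is shifted by the order of the other factor. The constant vector
  (eigenvalue \<open>0\<close>) and the vector that is \<open>n\<^sub>2\<close> on the first factor and \<open>- n\<^sub>1\<close> on the second one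
  (eigenvalue \<open>n\<^sub>1 + n\<^sub>2\<close>) complete the eigenbasis.\<close>

section \<open>The spectral theorem for self-adjoint maps\<close>

text \<open>A maximiser \<open>v\<close> of the Rayleigh quotient on the compact unit sphere of
  \<open>S\<close> is an eigenvector: a nonzero residual \<open>f v - c v\<close> would be a
  direction of ascent.\<close>

lemma self_adjoint_eigenvector:
  fixes f :: "'a::euclidean_space \<Rightarrow> 'a"
  assumes "linear f" and adj: "\<And>x y. f x \<bullet> y = x \<bullet> f y"
    and S: "subspace S" and inv: "f ` S \<subseteq> S" and "S \<noteq> {0}"
  obtains v c where "v \<in> S" "norm v = 1" "f v = c *\<^sub>R v"
proof -
  interpret linear f by fact
  have cont: "continuous_on T f" for T
    using \<open>linear f\<close> by (simp add: linear_continuous_on linear_conv_bounded_linear)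
  let ?K = "S \<inter> sphere 0 1"
  obtain x where x: "x \<in> S" "x \<noteq> 0"
    using \<open>S \<noteq> {0}\<close> subspace_0[OF S] by blast
  have "(1 / norm x) *\<^sub>R x \<in> ?K"
    using x S by (simp add: subspace_scale)
  moreover have "compact ?K"
    using S by (simp add: closed_Int_compact closed_subspace)
  moreover have "continuous_on ?K (\<lambda>x. f x \<bullet> x)"
    by (intro continuous_intros cont)
  ultimately obtain v where v: "v \<in> ?K" and max: "\<And>y. y \<in> ?K \<Longrightarrow> f y \<bullet> y \<le> f v \<bullet> v"
    using continuous_attains_sup[of ?K "\<lambda>x. f x \<bullet> x"] by blast
  define c where "c = f v \<bullet> v"
  \<comment> \<open>By homogeneity, maximality on the unit sphere extends to all of
    \<open>S\<close>.\<close>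
  have rayleigh: "f w \<bullet> w \<le> c * (w \<bullet> w)" if "w \<in> S" for w
  proof (cases "w = 0")
    case False
    have "(1 / norm w) *\<^sub>R w \<in> ?K"
      using False that S by (simp add: subspace_scale)
    from max[OF this] show ?thesis
      using False by (simp add: scale c_def dot_square_norm field_simps power2_eq_square)
  qed (simp add: zero)
  have vv: "v \<bullet> v = 1" "v \<in> S"
    using v by (auto simp: norm_eq_1)
  define g where "g = f v - c *\<^sub>R v"
  have g: "g \<in> S"
    unfolding g_def using vv S inv by (intro subspace_diff subspace_scale) auto
  define K where "K = c * (g \<bullet> g) - f g \<bullet> g"
  \<comment> \<open>The Rayleigh quotient does not increase from \<open>v\<close> in the direction of its gradient \<open>2 g\<close>.\<close>
  have bound: "2 * (g \<bullet> g) \<le> t * K" if "t > 0" for t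
  proof -
    have "v + t *\<^sub>R g \<in> S"
      using vv g S by (simp add: subspace_add subspace_scale)
    from rayleigh[OF this]
    have "c + 2 * t * (f v \<bullet> g) + t\<^sup>2 * (f g \<bullet> g) \<le> c + 2 * t * c * (v \<bullet> g) + t\<^sup>2 * c * (g \<bullet> g)"
      using vv adj[of g v]
      by (simp add: add scale inner_add_left inner_add_right c_def inner_commute algebra_simps
          power2_eq_square)
    \<comment> \<open>Only one factor of \<open>g \<bullet> g\<close> is unfolded; this is exactly
      the term linear in \<open>t\<close>.\<close>
    moreover have "t * (2 * (g \<bullet> g)) = 2 * t * (f v \<bullet> g) - 2 * t * c * (v \<bullet> g)"
      by (subst (1) g_def) (simp add: inner_diff_left algebra_simps)
    ultimately have "t * (2 * (g \<bullet> g)) \<le> t * (t * K)"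
      by (simp add: K_def algebra_simps power2_eq_square)
    then show ?thesis
      using that by simp
  qed
  have "2 * (g \<bullet> g) \<le> 0"
  proof (rule tendsto_lowerbound)
    show "((\<lambda>t. t * K) \<longlongrightarrow> 0) (at_right 0)"
      by (auto intro!: tendsto_eq_intros)
    show "\<forall>\<^sub>F t in at_right 0. 2 * (g \<bullet> g) \<le> t * K"
      using bound by (auto simp: eventually_at_right_field intro: exI[of _ 1])
  qed simp
  then have "g \<bullet> g \<le> 0"
    by linarith
  then have "g = 0"
    by (metis inner_eq_zero_iff inner_ge_zero order_antisym)
  with v vv show thesis
    by (intro that[of v c]) (auto simp: g_def)
qed

lemma dim_orthogonal_complement_vector:
  fixes v :: "'a::euclidean_space"
  assumes "subspace S" "v \<in> S" "v \<noteq> 0"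
  shows "Suc (dim {y \<in> S. v \<bullet> y = 0}) = dim S"
proof -
  have "dim {y \<in> S. \<forall>x\<in>span {v}. orthogonal x y} + dim (span {v}) = dim S"
    using assms by (intro dim_subspace_orthogonal_to_vectors) (auto simp: span_minimal)
  moreover have "{y \<in> S. \<forall>x\<in>span {v}. orthogonal x y} = {y \<in> S. v \<bullet> y = 0}"
    by (auto simp: span_singleton orthogonal_def)
  ultimately show ?thesis
    using assms by simp
qed

text \<open>Induction on the dimension: split off one eigenvector; by self-adjointness its
  orthogonal complement within \<open>S\<close> is again invariant. The version for subspaces serves
  this induction and is later applied to the complement of the constants.\<close>

lemma spectral_theorem_subspace:
  fixes f :: "'a::euclidean_space \<Rightarrow> 'a"
  assumes "linear f" and adj: "\<And>x y. f x \<bullet> y = x \<bullet> f y"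
    and "subspace S" "f ` S \<subseteq> S"
  shows "\<exists>B. B \<subseteq> S \<and> finite B \<and> card B = dim S \<and> pairwise orthogonal B \<and>
    (\<forall>b\<in>B. norm b = 1 \<and> (\<exists>c. f b = c *\<^sub>R b))"
  using assms(3,4)
proof (induction "dim S" arbitrary: S)
  case 0
  then show ?case
    by (intro exI[of _ "{}"]) auto
next
  case (Suc n)
  then have "S \<noteq> {0}"
    by auto
  then obtain v c where v: "v \<in> S" "norm v = 1" "f v = c *\<^sub>R v"
    using self_adjoint_eigenvector[OF assms(1) adj Suc.prems] by metis
  let ?T = "{y \<in> S. v \<bullet> y = 0}"
  have T: "subspace ?T"
    using Suc.prems(1) by (auto simp: subspace_def inner_add_right)
  have "Suc (dim ?T) = dim S"
    using Suc.prems(1) v by (intro dim_orthogonal_complement_vector) auto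
  then have n: "n = dim ?T"
    using Suc.hyps(2) by simp
  have "f ` ?T \<subseteq> ?T"
    using Suc.prems(2) by (auto simp: v(3) simp flip: adj)
  from Suc.hyps(1)[OF n T this] obtain B where B: "B \<subseteq> ?T" "finite B" "card B = dim ?T"
    "pairwise orthogonal B" "\<forall>b\<in>B. norm b = 1 \<and> (\<exists>c. f b = c *\<^sub>R b)"
    by blast
  have "v \<notin> B"
    using B(1) v(2) by auto
  then have "card (insert v B) = dim S"
    using B Suc.hyps(2) n by simp
  moreover have "pairwise orthogonal (insert v B)"
    using B by (auto simp: pairwise_insert orthogonal_def inner_commute)
  ultimately show ?case
    using B v by (intro exI[of _ "insert v B"]) auto
qed

section \<open>Orthonormal eigenbases of real matrices\<close>

text \<open>Indexing the vectors by the type \<open>'n\<close> fixes their number at the dimension,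
  so orthonormality makes them a basis and \<open>\<mu>\<close> lists the eigenvalues with
  multiplicity, in no particular order.\<close>

definition orthonormal_eigenbasis ::
    "real^'n^'n \<Rightarrow> ('n::finite \<Rightarrow> real^'n) \<Rightarrow> ('n \<Rightarrow> real) \<Rightarrow> bool" where
  "orthonormal_eigenbasis A e \<mu> \<longleftrightarrow>
     (\<forall>i j. e i \<bullet> e j = of_bool (i = j)) \<and> (\<forall>i. A *v e i = \<mu> i *\<^sub>R e i)"

text \<open>The matrix with columns \<open>e j\<close> is orthogonal, so it cancels from
  \<open>A ** P = B ** P\<close>.\<close>

lemma matrix_eq_on_orthonormal_basis:
  fixes A B :: "real^'n^'n" and e :: "'n \<Rightarrow> real^'n"
  assumes e: "\<And>i j. e i \<bullet> e j = of_bool (i = j)"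
    and eq: "\<And>i. A *v e i = B *v e i"
  shows "A = B"
proof -
  define P :: "real^'n^'n" where "P = (\<chi> i j. e j $ i)"
  have col: "column j P = e j" for j
    by (simp add: P_def column_def)
  have "orthogonal_matrix P"
    by (auto simp: orthogonal_matrix_orthonormal_columns col norm_eq_1 orthogonal_def e)
  then have P: "P ** transpose P = mat 1"
    by (simp add: orthogonal_matrix_def)
  have "A ** P = B ** P"
    using eq by (simp add: vec_eq_iff matrix_matrix_mult_def matrix_vector_mult_def P_def)
  then have "A ** (P ** transpose P) = B ** (P ** transpose P)"
    by (simp add: matrix_mul_assoc)
  then show ?thesis
    by (simp add: P)
qed

text \<open>Diagonalisation is carried out over the polynomial ring: with the eigenvectors as
  constant polynomial columns of \<open>P\<close>, one has \<open>X ** P = P ** D\<close>, and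
  \<open>det P\<close> cancels because polynomials over the reals form an integral domain.\<close>

lemma characteristic_poly_eigenbasis:
  fixes A :: "real^'n^'n"
  assumes "orthonormal_eigenbasis A e \<mu>"
  shows "characteristic_poly A = (\<Prod>i\<in>UNIV. [:- \<mu> i, 1:])"
proof -
  have e: "e i \<bullet> e j = of_bool (i = j)" and A: "A *v e i = \<mu> i *\<^sub>R e i" for i j
    using assms by (auto simp: orthonormal_eigenbasis_def)
  define P :: "real poly^'n^'n" where "P = (\<chi> i j. [:e j $ i:])"
  define D :: "real poly^'n^'n" where "D = (\<chi> i j. if i = j then [:- \<mu> i, 1:] else 0)"
  define X :: "real poly^'n^'n" where
    "X = (\<chi> i j. (if i = j then [:0, 1:] else 0) - [:A $ i $ j:])"
  have sum_const: "(\<Sum>a\<in>S. [:h a:]) = [:\<Sum>a\<in>S. h a:]" for h :: "'n \<Rightarrow> real" and S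
    by (induction S rule: infinite_finite_induct) auto
  have "transpose P ** P = mat 1"
    using e by (simp add: vec_eq_iff matrix_matrix_mult_def transpose_def P_def mat_def sum_const
        inner_vec_def of_bool_def one_pCons)
  then have "det P * det P = 1"
    by (metis det_I det_mul det_transpose)
  then have "det P \<noteq> 0"
    by auto
  have "X ** P = P ** D"
  proof -
    have "(X ** P) $ a $ j = (P ** D) $ a $ j" for a j
    proof -
      have "(X ** P) $ a $ j =
          (\<Sum>b\<in>UNIV. (if a = b then [:0, 1:] * [:e j $ b:] else 0) - [:A $ a $ b * e j $ b:])"
        by (auto simp: matrix_matrix_mult_def X_def P_def algebra_simps intro!: sum.cong)
      also have "\<dots> = [:0, 1:] * [:e j $ a:] - [:(A *v e j) $ a:]"
        by (simp only: sum_subtractf sum_const) (simp add: matrix_vector_mult_def)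
      also have "\<dots> = [:e j $ a:] * [:- \<mu> j, 1:]"
        by (simp add: A)
      also have "\<dots> = (P ** D) $ a $ j"
        by (simp add: matrix_matrix_mult_def P_def D_def if_distrib[of "smult c" for c] cong: if_cong)
      finally show ?thesis .
    qed
    then show ?thesis
      by (simp add: vec_eq_iff)
  qed
  then have "det X * det P = det D * det P"
    by (metis det_mul mult.commute)
  with \<open>det P \<noteq> 0\<close> have "det X = det D"
    by simp
  also have "\<dots> = (\<Prod>i\<in>UNIV. [:- \<mu> i, 1:])"
    by (subst det_diagonal) (auto simp: D_def)
  finally show ?thesis
    by (simp add: characteristic_poly_def X_def)
qed

lemma proots_characteristic_poly_eigenbasis:
  fixes A :: "real^'n^'n"
  assumes "orthonormal_eigenbasis A e \<mu>"
  shows "proots (characteristic_poly A) = image_mset \<mu> (mset_set UNIV)"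
proof -
  have "(\<Sum>i\<in>S. {#\<mu> i#}) = image_mset \<mu> (mset_set S)" for S
    by (induction S rule: infinite_finite_induct) auto
  then show ?thesis
    by (simp add: characteristic_poly_eigenbasis[OF assms] proots_prod)
qed

section \<open>Functional calculus in an eigenbasis and the Moore-Penrose inverse\<close>

definition spectral_matrix :: "('n::finite \<Rightarrow> real^'n) \<Rightarrow> ('n \<Rightarrow> real) \<Rightarrow> real^'n^'n" where
  "spectral_matrix e f = (\<chi> a b. \<Sum>i\<in>UNIV. f i * e i $ a * e i $ b)"

lemma transpose_spectral_matrix [simp]: "transpose (spectral_matrix e f) = spectral_matrix e f"
  by (simp add: spectral_matrix_def transpose_def mult_ac)

lemma spectral_matrix_vector_mult:
  assumes "\<And>i j. e i \<bullet> e j = of_bool (i = j)"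
  shows "spectral_matrix e f *v e j = f j *\<^sub>R e j"
proof -
  have "(spectral_matrix e f *v e j) $ a = (f j *\<^sub>R e j) $ a" for a
  proof -
    have "(spectral_matrix e f *v e j) $ a = (\<Sum>i\<in>UNIV. f i * e i $ a * (e i \<bullet> e j))"
      unfolding spectral_matrix_def matrix_vector_mult_def
      by (simp add: sum_distrib_right sum_distrib_left inner_vec_def mult_ac) (rule sum.swap)
    also have "\<dots> = f j * e j $ a"
      by (simp add: assms of_bool_def if_distrib if_distribR cong: if_cong)
    finally show ?thesis
      by simp
  qed
  then show ?thesis
    by (simp add: vec_eq_iff)
qed

text \<open>Both sides agree on each \<open>e i\<close>. Matrix identities thereby reduce to
  identities between eigenvalues.\<close>

lemma spectral_matrix_mult:
  assumes e: "\<And>i j. e i \<bullet> e j = of_bool (i = j)"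
  shows "spectral_matrix e f ** spectral_matrix e g = spectral_matrix e (\<lambda>i. f i * g i)"
  by (rule matrix_eq_on_orthonormal_basis[OF e])
    (simp add: spectral_matrix_vector_mult[OF e] matrix_vector_mult_scaleR mult.commute
      flip: matrix_vector_mul_assoc)

lemma eigenbasis_imp_spectral_matrix:
  assumes "orthonormal_eigenbasis A e \<mu>"
  shows "A = spectral_matrix e \<mu>"
  using assms unfolding orthonormal_eigenbasis_def
  by (intro matrix_eq_on_orthonormal_basis[of e]) (auto simp: spectral_matrix_vector_mult)

text \<open>Penrose's argument: symmetry of the products forces \<open>A ** X = A ** Y\<close> and
  \<open>X ** A = Y ** A\<close>, whence X = XAX = XAY = YAY = Y.\<close>

lemma moore_penrose_unique:
  fixes A :: "real^'n^'m" and X Y :: "real^'m^'n"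
  assumes X: "A ** X ** A = A" "X ** A ** X = X"
      "transpose (A ** X) = A ** X" "transpose (X ** A) = X ** A"
    and Y: "A ** Y ** A = A" "Y ** A ** Y = Y"
      "transpose (A ** Y) = A ** Y" "transpose (Y ** A) = Y ** A"
  shows "X = Y"
proof -
  have AX: "A ** X = A ** Y"
  proof -
    have "A ** X = (A ** Y) ** (A ** X)"
      by (metis Y(1) matrix_mul_assoc)
    also have "\<dots> = transpose ((A ** X) ** (A ** Y))"
      by (simp only: matrix_transpose_mul[of "A ** X" "A ** Y"] X(3) Y(3))
    also have "(A ** X) ** (A ** Y) = A ** Y"
      by (metis X(1) matrix_mul_assoc)
    finally show ?thesis
      by (simp add: Y(3))
  qed
  have XA: "X ** A = Y ** A"
  proof -
    have "X ** A = (X ** A) ** (Y ** A)"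
      by (metis Y(1) matrix_mul_assoc)
    also have "\<dots> = transpose ((Y ** A) ** (X ** A))"
      by (simp only: matrix_transpose_mul[of "Y ** A" "X ** A"] X(4) Y(4))
    also have "(Y ** A) ** (X ** A) = Y ** A"
      by (metis X(1) matrix_mul_assoc)
    finally show ?thesis
      by (simp add: Y(4))
  qed
  show ?thesis
    by (metis AX XA X(2) Y(2) matrix_mul_assoc)
qed

lemma pseudoinverse_eigenbasis:
  assumes "orthonormal_eigenbasis A e \<mu>"
  shows "pseudoinverse A = spectral_matrix e (\<lambda>i. inverse (\<mu> i))"
proof -
  have e: "e i \<bullet> e j = of_bool (i = j)" for i j
    using assms by (auto simp: orthonormal_eigenbasis_def)
  \<comment> \<open>Since \<open>inverse 0 = 0\<close>, these hold on the kernel as well.\<close>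
  have eq: "\<mu> i * inverse (\<mu> i) * \<mu> i = \<mu> i"
    "inverse (\<mu> i) * \<mu> i * inverse (\<mu> i) = inverse (\<mu> i)" for i
    by (cases "\<mu> i = 0"; simp)+
  note A = eigenbasis_imp_spectral_matrix[OF assms]
  let ?X = "spectral_matrix e (\<lambda>i. inverse (\<mu> i))"
  have X: "A ** ?X ** A = A" "?X ** A ** ?X = ?X"
    "transpose (A ** ?X) = A ** ?X" "transpose (?X ** A) = ?X ** A"
    by (simp_all add: A spectral_matrix_mult[OF e] eq)
  show ?thesis
    unfolding pseudoinverse_def
  proof (rule the_equality)
    show "A ** ?X ** A = A \<and> ?X ** A ** ?X = ?X \<and>
        transpose (A ** ?X) = A ** ?X \<and> transpose (?X ** A) = ?X ** A"
      using X by simp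
  next
    fix Y
    assume "A ** Y ** A = A \<and> Y ** A ** Y = Y \<and>
        transpose (A ** Y) = A ** Y \<and> transpose (Y ** A) = Y ** A"
    then show "Y = ?X"
      by (intro moore_penrose_unique[OF _ _ _ _ X]) (elim conjE, assumption)+
  qed
qed

section \<open>Spectra of graph Laplacians\<close>

lemma laplacian_mult_vec:
  assumes "simple_graph E"
  shows "(laplacian E *v x) $ u = (\<Sum>w\<in>UNIV. of_bool (E u w) * (x $ u - x $ w))"
proof -
  have "(laplacian E *v x) $ u =
      (\<Sum>w\<in>UNIV. (if u = w then real (card {w. E u w}) * x $ w else 0) - of_bool (E u w) * x $ w)"
    by (auto simp: laplacian_def degree_matrix_def adjacency_matrix_def matrix_vector_mult_def
        algebra_simps intro!: sum.cong)
  also have "\<dots> = real (card {w. E u w}) * x $ u - (\<Sum>w\<in>UNIV. of_bool (E u w) * x $ w)"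
    by (simp add: sum_subtractf)
  also have "real (card {w. E u w}) = (\<Sum>w\<in>UNIV. of_bool (E u w))"
    by (simp add: of_bool_def sum.If_cases)
  finally show ?thesis
    by (simp add: sum_subtractf sum_distrib_right algebra_simps)
qed

lemma laplacian_sym: "simple_graph E \<Longrightarrow> transpose (laplacian E) = laplacian E"
  by (auto simp: transpose_def laplacian_def degree_matrix_def adjacency_matrix_def vec_eq_iff
      simple_graph_def dest: sympD)

lemma laplacian_const: "simple_graph E \<Longrightarrow> laplacian E *v vec c = 0"
  by (simp add: vec_eq_iff laplacian_mult_vec)

text \<open>Averaging over the two orders of each pair turns the quadratic form into half a sum of
  squared differences along edges. Nonnegativity later puts the eigenvalue 0 at the head of the
  sorted spectrum.\<close>

lemma laplacian_nonneg:
  assumes "simple_graph E"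
  shows "0 \<le> x \<bullet> (laplacian E *v x)"
proof -
  let ?s = "\<Sum>u\<in>UNIV. \<Sum>w\<in>UNIV. of_bool (E u w) * (x $ u * (x $ u - x $ w))"
  have eq: "x \<bullet> (laplacian E *v x) = ?s"
    by (simp only: inner_vec_def laplacian_mult_vec[OF assms] sum_distrib_left inner_real_def
        mult.left_commute)
  have "E u w = E w u" for u w
    using assms by (auto simp: simple_graph_def dest: sympD)
  then have "?s = (\<Sum>u\<in>UNIV. \<Sum>w\<in>UNIV. of_bool (E u w) * (x $ w * (x $ w - x $ u)))"
    by (subst sum.swap) (simp only:)
  then have "2 * ?s =
      ?s + (\<Sum>u\<in>UNIV. \<Sum>w\<in>UNIV. of_bool (E u w) * (x $ w * (x $ w - x $ u)))"
    by linarith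
  also have "\<dots> = (\<Sum>u\<in>UNIV. \<Sum>w\<in>UNIV. of_bool (E u w) * (x $ u - x $ w)\<^sup>2)"
    by (simp only: sum.distrib[symmetric])
      (intro sum.cong refl, simp add: algebra_simps power2_eq_square)
  also have "\<dots> \<ge> 0"
    by (intro sum_nonneg) auto
  finally show ?thesis
    by (simp add: eq)
qed

lemma inner_vec_const: "vec c \<bullet> (x :: real^'n) = c * (\<Sum>i\<in>UNIV. x $ i)"
  by (simp add: inner_vec_def sum_distrib_left)

text \<open>For a disconnected graph the eigenvalue 0 is multiple, and an arbitrary eigenbasis may
  miss the constant vector. Hence the constant vector is chosen first and the spectral theorem is
  applied to its orthogonal complement.\<close>

lemma laplacian_eigenbasis_exists:
  fixes E :: "'a::finite \<Rightarrow> 'a \<Rightarrow> bool"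
  assumes "simple_graph E"
  obtains e \<mu> k where "orthonormal_eigenbasis (laplacian E) e \<mu>"
    "e k = vec (1 / sqrt CARD('a))" "\<mu> k = 0" "\<And>i. \<mu> i \<ge> 0"
proof -
  let ?f = "(*v) (laplacian E)"
  define o1 :: "real^'a" where "o1 = vec (1 / sqrt CARD('a))"
  have o1: "norm o1 = 1"
    by (simp add: norm_eq_1 o1_def inner_vec_const)
  have f_o1: "?f o1 = 0"
    by (simp add: o1_def laplacian_const assms)
  have adj: "?f x \<bullet> y = x \<bullet> ?f y" for x y
    by (metis assms dot_lmul_matrix laplacian_sym transpose_matrix_vector)
  let ?S = "{y \<in> UNIV. o1 \<bullet> y = 0}"
  have S: "subspace ?S"
    by (auto simp: subspace_def inner_add_right)
  have "?f ` ?S \<subseteq> ?S"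
    using adj[of o1] f_o1 by auto
  from spectral_theorem_subspace[OF matrix_vector_mul_linear adj S this]
  obtain B where B: "B \<subseteq> ?S" "finite B" "card B = dim ?S" "pairwise orthogonal B"
    "\<forall>b\<in>B. norm b = 1 \<and> (\<exists>c. ?f b = c *\<^sub>R b)"
    by blast
  have "o1 \<notin> B"
    using B(1) o1 by auto
  moreover have "Suc (dim ?S) = CARD('a)"
    using dim_orthogonal_complement_vector[of UNIV o1] o1 by fastforce
  ultimately have "card (insert o1 B) = CARD('a)"
    using B by simp
  \<comment> \<open>The basis has as many elements as the graph has vertices, so the vertices can
    index it.\<close>
  then obtain e where e: "bij_betw e (UNIV :: 'a set) (insert o1 B)"
    using B(2) finite_same_card_bij[of "UNIV :: 'a set" "insert o1 B"] by auto
  have eB: "e i \<in> insert o1 B" for i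
    using e by (auto simp: bij_betw_def)
  have "\<exists>c. ?f b = c *\<^sub>R b" if "b \<in> insert o1 B" for b
    using that B(5) f_o1 by (auto intro: exI[of _ 0])
  then have "\<forall>i. \<exists>c. ?f (e i) = c *\<^sub>R e i"
    using eB by blast
  then obtain \<mu> where \<mu>: "\<And>i. ?f (e i) = \<mu> i *\<^sub>R e i"
    by metis
  have norm: "norm (e i) = 1" for i
    using eB[of i] B(5) o1 by auto
  have "pairwise orthogonal (insert o1 B)"
    using B by (auto simp: pairwise_insert orthogonal_def inner_commute)
  then have orth: "e i \<bullet> e j = of_bool (i = j)" for i j
  proof (cases "i = j")
    case True
    then show ?thesis
      using norm[of j] by (simp add: norm_eq_1)
  next
    case False
    then have "e i \<noteq> e j"
      using e by (simp add: bij_betw_def inj_eq)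
    then show ?thesis
      using pairwiseD[OF \<open>pairwise orthogonal (insert o1 B)\<close> eB eB] False
      by (simp add: orthogonal_def)
  qed
  obtain k where k: "e k = o1"
    using e by (metis bij_betw_imp_surj_on imageE insertI1)
  have inner: "e i \<bullet> ?f (e i) = \<mu> i" for i
    by (simp add: \<mu> orth)
  show thesis
  proof
    show "orthonormal_eigenbasis (laplacian E) e \<mu>"
      by (simp add: orthonormal_eigenbasis_def orth \<mu>)
    show "e k = vec (1 / sqrt CARD('a))"
      by (simp add: k o1_def)
    show "\<mu> k = 0"
      using inner[of k] k f_o1 by simp
    show "\<mu> i \<ge> 0" for i
      using inner[of i] laplacian_nonneg[OF assms] by metis
  qed
qed

text \<open>All eigenvalues are nonnegative, so a 0 heads the sorted list; starting the sum at 2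
  drops it, which at the level of multisets is the removal of the index \<open>k\<close>.\<close>

lemma sum_laplacian_eigenvalue:
  fixes E :: "'a::finite \<Rightarrow> 'a \<Rightarrow> bool" and f :: "real \<Rightarrow> real"
  assumes "orthonormal_eigenbasis (laplacian E) e \<mu>" "\<mu> k = 0" "\<And>i. \<mu> i \<ge> 0"
  shows "(\<Sum>i=2..CARD('a). f (laplacian_eigenvalue E i)) = (\<Sum>i\<in>UNIV - {k}. f (\<mu> i))"
proof -
  define M where "M = image_mset \<mu> (mset_set (UNIV - {k}))"
  define l where "l = sorted_list_of_multiset M"
  have "mset_set UNIV = add_mset k (mset_set (UNIV - {k}))"
    by (simp add: mset_set.remove)
  then have "proots (characteristic_poly (laplacian E)) = add_mset 0 M"
    by (simp add: proots_characteristic_poly_eigenbasis[OF assms(1)] M_def assms(2))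
  moreover have "sorted_list_of_multiset (add_mset 0 M) = 0 # l"
    using assms(3) by (simp add: l_def M_def insort_is_Cons)
  ultimately have ev: "laplacian_eigenvalue E i = (0 # l) ! (i - 1)" for i
    by (simp add: laplacian_eigenvalue_def)
  have mset_l: "mset l = M"
    by (simp add: l_def)
  have "length l = CARD('a) - 1"
    by (metis mset_l M_def size_mset size_image_mset size_mset_set card_Diff_singleton UNIV_I)
  then have len: "CARD('a) = Suc (length l)"
    by simp
  \<comment> \<open>Indices shift by two: once because eigenvalues are counted from 1, once for the
    leading 0.\<close>
  have "(\<Sum>i=2..CARD('a). f (laplacian_eigenvalue E i)) = (\<Sum>i<length l. f (l ! i))"
    unfolding len ev
    by (rule sum.reindex_bij_witness[of _ "\<lambda>i. i + 2" "\<lambda>i. i - 2"])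
      (auto simp: nth_Cons' numeral_2_eq_2)
  also have "\<dots> = sum_list (map f l)"
    by (simp add: sum_list_sum_nth atLeast0LessThan)
  also have "\<dots> = sum_mset (image_mset f (mset l))"
    by (simp flip: sum_mset_sum_list)
  also have "\<dots> = (\<Sum>i\<in>UNIV - {k}. f (\<mu> i))"
    by (simp add: mset_l M_def sum_unfold_sum_mset image_mset.compositionality comp_def)
  finally show ?thesis .
qed

text \<open>The matrix \<open>M\<close>, the squared pseudoinverse, annihilates the constants, so
  its rows sum to 0. The mixed terms of the double sum vanish, and the diagonal ones give the order
  of the graph times the trace of \<open>M\<close>.\<close>

lemma biharmonic_index_eigenbasis:
  fixes E :: "'a::finite \<Rightarrow> 'a \<Rightarrow> bool"
  assumes eig: "orthonormal_eigenbasis (laplacian E) e \<mu>"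
    and k: "e k = vec c" "c \<noteq> 0" "\<mu> k = 0"
  shows "biharmonic_index E = real CARD('a) * (\<Sum>i\<in>UNIV - {k}. 1 / (\<mu> i)\<^sup>2)"
proof -
  have e: "e i \<bullet> e j = of_bool (i = j)" for i j
    using eig by (auto simp: orthonormal_eigenbasis_def)
  define g where "g = (\<lambda>i. 1 / (\<mu> i)\<^sup>2)"
  define M where "M = spectral_matrix e g"
  have M: "pseudoinverse (laplacian E) ** pseudoinverse (laplacian E) = M"
    by (simp add: pseudoinverse_eigenbasis[OF eig] spectral_matrix_mult[OF e] M_def g_def
        power2_eq_square field_simps)
  have "(\<Sum>u\<in>UNIV. M $ u $ u) = (\<Sum>i\<in>UNIV. g i * (e i \<bullet> e i))"
    unfolding M_def spectral_matrix_def
    by (simp add: inner_vec_def sum_distrib_left mult_ac) (rule sum.swap)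
  \<comment> \<open>The index \<open>k\<close> contributes \<open>g k = 1 / 0 = 0\<close>.\<close>
  also have "\<dots> = (\<Sum>i\<in>UNIV - {k}. g i)"
    using k(3) by (simp add: e sum.remove[of UNIV k] g_def)
  finally have trace: "(\<Sum>u\<in>UNIV. M $ u $ u) = (\<Sum>i\<in>UNIV - {k}. g i)" .
  have "M *v e k = 0"
    by (simp add: M_def spectral_matrix_vector_mult[OF e] g_def k(3))
  then have row: "(\<Sum>v\<in>UNIV. M $ u $ v) = 0" for u
    using k(1,2) by (simp add: vec_eq_iff matrix_vector_mult_def flip: sum_distrib_right)
  have "biharmonic_index E =
      1/2 * (\<Sum>u\<in>UNIV. \<Sum>v\<in>UNIV. M $ u $ u + M $ v $ v - 2 * M $ u $ v)"
    by (simp add: biharmonic_index_def biharmonic_dist_sq_def M)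
  also have "\<dots> = real CARD('a) * (\<Sum>u\<in>UNIV. M $ u $ u)"
    by (simp add: sum.distrib sum_subtractf row flip: sum_distrib_left)
  finally show ?thesis
    by (simp add: trace g_def)
qed

section \<open>The spectrum of a join\<close>

lemma sum_UNIV_Plus:
  "(\<Sum>s\<in>UNIV. f s) = (\<Sum>u\<in>UNIV. f (Inl u)) + (\<Sum>v\<in>UNIV. f (Inr v))"
  for f :: "'a::finite + 'b::finite \<Rightarrow> 'c::comm_monoid_add"
  by (simp add: sum.Plus flip: UNIV_Plus_UNIV)

lemma simple_graph_join:
  assumes "simple_graph E1" "simple_graph E2"
  shows "simple_graph (graph_join E1 E2)"
proof -
  have "graph_join E1 E2 s t \<Longrightarrow> graph_join E1 E2 t s" "\<not> graph_join E1 E2 s s" for s t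
    using assms by (cases s; cases t; auto simp: simple_graph_def dest: sympD irreflpD)+
  then show ?thesis
    by (auto simp: simple_graph_def intro!: sympI irreflpI)
qed

definition join_vec :: "real^'a \<Rightarrow> real^'b \<Rightarrow> real^('a + 'b)" where
  "join_vec x y = (\<chi> s. case s of Inl u \<Rightarrow> x $ u | Inr v \<Rightarrow> y $ v)"

lemma join_vec_nth [simp]:
  "join_vec x y $ Inl u = x $ u" "join_vec x y $ Inr v = y $ v"
  by (simp_all add: join_vec_def)

lemma inner_join_vec: "join_vec x y \<bullet> join_vec x' y' = x \<bullet> x' + y \<bullet> y'"
  by (simp add: inner_vec_def sum_UNIV_Plus)

text \<open>At a vertex \<open>u\<close> of the first factor, the cross edges add the sum of
  \<open>x $ u - y $ v\<close> over all \<open>v\<close>. This shifts by the order of the other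
  factor, and the coupling between the factors is only through coordinate sums.\<close>

lemma laplacian_join_mult:
  fixes E1 :: "'a::finite \<Rightarrow> 'a \<Rightarrow> bool" and E2 :: "'b::finite \<Rightarrow> 'b \<Rightarrow> bool"
  assumes "simple_graph E1" "simple_graph E2"
  shows "laplacian (graph_join E1 E2) *v join_vec x y =
    join_vec (laplacian E1 *v x + real CARD('b) *\<^sub>R x - vec (\<Sum>v\<in>UNIV. y $ v))
      (laplacian E2 *v y + real CARD('a) *\<^sub>R y - vec (\<Sum>u\<in>UNIV. x $ u))"
    (is "?l = ?r")
proof -
  have "?l $ s = ?r $ s" for s
    by (cases s) (simp_all add: laplacian_mult_vec simple_graph_join assms sum_UNIV_Plus
        sum_subtractf)
  then show ?thesis
    by (simp add: vec_eq_iff)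
qed

text \<open>The two constant vectors of the factors free the slots \<open>Inl k1\<close> and
  \<open>Inr k2\<close>, which receive the constant vector of the join and the vector balancing the
  factors. The latter has squared norm \<open>s * s * (n1 * n2 * (n1 + n2))\<close>, which
  determines \<open>s\<close>.\<close>

lemma eigenbasis_join:
  fixes E1 :: "'a::finite \<Rightarrow> 'a \<Rightarrow> bool" and E2 :: "'b::finite \<Rightarrow> 'b \<Rightarrow> bool"
  assumes graphs: "simple_graph E1" "simple_graph E2"
    and eig1: "orthonormal_eigenbasis (laplacian E1) e1 \<mu>1"
    and k1: "e1 k1 = vec c1" "c1 \<noteq> 0"
    and eig2: "orthonormal_eigenbasis (laplacian E2) e2 \<mu>2"
    and k2: "e2 k2 = vec c2" "c2 \<noteq> 0"
  defines "n1 \<equiv> real CARD('a)" and "n2 \<equiv> real CARD('b)"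
  defines "c \<equiv> 1 / sqrt (n1 + n2)" and "s \<equiv> 1 / sqrt (n1 * n2 * (n1 + n2))"
  defines "e \<equiv> case_sum
      (\<lambda>i. if i = k1 then join_vec (vec c) (vec c) else join_vec (e1 i) 0)
      (\<lambda>j. if j = k2 then join_vec (vec (s * n2)) (vec (- s * n1)) else join_vec 0 (e2 j))"
    and "\<mu> \<equiv> case_sum
      (\<lambda>i. if i = k1 then 0 else \<mu>1 i + n2) (\<lambda>j. if j = k2 then n1 + n2 else \<mu>2 j + n1)"
  shows "orthonormal_eigenbasis (laplacian (graph_join E1 E2)) e \<mu>"
proof -
  have e1: "e1 i \<bullet> e1 j = of_bool (i = j)" "laplacian E1 *v e1 i = \<mu>1 i *\<^sub>R e1 i" for i j
    using eig1 by (auto simp: orthonormal_eigenbasis_def)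
  have e2: "e2 i \<bullet> e2 j = of_bool (i = j)" "laplacian E2 *v e2 i = \<mu>2 i *\<^sub>R e2 i" for i j
    using eig2 by (auto simp: orthonormal_eigenbasis_def)
  \<comment> \<open>Orthogonality to the constant vector makes the coordinate sum vanish, so the
    extension by zero stays an eigenvector.\<close>
  have sum1: "(\<Sum>u\<in>UNIV. e1 i $ u) = 0" if "i \<noteq> k1" for i
    using e1(1)[of k1 i] that k1 by (simp add: inner_vec_const)
  have sum2: "(\<Sum>u\<in>UNIV. e2 i $ u) = 0" if "i \<noteq> k2" for i
    using e2(1)[of k2 i] that k2 by (simp add: inner_vec_const)
  have pos: "n1 > 0" "n2 > 0"
    by (simp_all add: n1_def n2_def)
  have sqrt_inverse: "1 / sqrt K * (1 / sqrt K) * K = 1" if "K > 0" for K :: real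
    using that by simp
  have "c * c * (n1 + n2) = 1"
    unfolding c_def using pos by (intro sqrt_inverse add_pos_pos)
  then have c: "n1 * (c * c) + n2 * (c * c) = 1"
    by (simp add: algebra_simps)
  have s: "s * s * (n1 * n2 * (n1 + n2)) = 1"
    unfolding s_def using pos by (intro sqrt_inverse mult_pos_pos add_pos_pos)
  have inner_const: "vec a \<bullet> (vec b :: real^'a) = n1 * (a * b)"
    "vec a \<bullet> (vec b :: real^'b) = n2 * (a * b)" for a b
    by (simp_all add: inner_vec_const n1_def n2_def)
  have inner_e: "vec a \<bullet> e1 i = 0" "e1 i \<bullet> vec a = 0" if "i \<noteq> k1" for a i
    using sum1[OF that] by (simp_all add: inner_vec_const inner_commute[of "e1 i"])
  have inner_e': "vec a \<bullet> e2 i = 0" "e2 i \<bullet> vec a = 0" if "i \<noteq> k2" for a i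
    using sum2[OF that] by (simp_all add: inner_vec_const inner_commute[of "e2 i"])
  have "e i \<bullet> e j = of_bool (i = j)" for i j
    using c s
    by (cases i; cases j)
      (auto simp: e_def inner_join_vec inner_const inner_e inner_e' e1 e2 algebra_simps)
  moreover have "laplacian (graph_join E1 E2) *v e i = \<mu> i *\<^sub>R e i" for i
  proof -
    have "(laplacian (graph_join E1 E2) *v e i) $ t = (\<mu> i *\<^sub>R e i) $ t" for t
      by (cases i; cases t)
        (auto simp: e_def \<mu>_def laplacian_join_mult graphs laplacian_const e1 e2 sum1 sum2
          algebra_simps simp flip: n1_def n2_def)
    then show ?thesis
      by (simp add: vec_eq_iff)
  qed
  ultimately show ?thesis
    by (simp add: orthonormal_eigenbasis_def)
qed

section \<open>The biharmonic index of a join\<close>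

theorem theorem6p2:
  fixes G1 :: "'a::finite \<Rightarrow> 'a \<Rightarrow> bool" and G2 :: "'b::finite \<Rightarrow> 'b \<Rightarrow> bool"
    and n1 n2 :: nat
  assumes "simple_graph G1" and "simple_graph G2"
    and "n1 = CARD('a)" and "n2 = CARD('b)"
  shows "biharmonic_index (graph_join G1 G2) =
    (real n1 + real n2) *
      (1 / (real n1 + real n2)\<^sup>2
       + (\<Sum>i=2..n1. 1 / (laplacian_eigenvalue G1 i + real n2)\<^sup>2)
       + (\<Sum>j=2..n2. 1 / (laplacian_eigenvalue G2 j + real n1)\<^sup>2))"
proof -
  obtain e1 \<mu>1 k1 where 1: "orthonormal_eigenbasis (laplacian G1) e1 \<mu>1"
      "e1 k1 = vec (1 / sqrt CARD('a))" "\<mu>1 k1 = 0" "\<And>i. \<mu>1 i \<ge> 0"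
    using laplacian_eigenbasis_exists[OF assms(1)] by blast
  obtain e2 \<mu>2 k2 where 2: "orthonormal_eigenbasis (laplacian G2) e2 \<mu>2"
      "e2 k2 = vec (1 / sqrt CARD('b))" "\<mu>2 k2 = 0" "\<And>i. \<mu>2 i \<ge> 0"
    using laplacian_eigenbasis_exists[OF assms(2)] by blast
  define \<mu> where "\<mu> = case_sum (\<lambda>i. if i = k1 then 0 else \<mu>1 i + real n2)
    (\<lambda>j. if j = k2 then real n1 + real n2 else \<mu>2 j + real n1)"
  let ?c = "1 / sqrt (real n1 + real n2)"
  \<comment> \<open>Beyond the spectrum \<open>\<mu>\<close>, the index formula only asks which
    eigenvector is constant; the others stay hidden.\<close>
  have "\<exists>e. orthonormal_eigenbasis (laplacian (graph_join G1 G2)) e \<mu> \<and>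
      e (Inl k1) = join_vec (vec ?c) (vec ?c)"
    unfolding \<mu>_def assms(3,4)
    by (rule exI, rule conjI, rule eigenbasis_join[OF assms(1,2) 1(1,2) _ 2(1,2)]) simp_all
  then obtain e where e: "orthonormal_eigenbasis (laplacian (graph_join G1 G2)) e \<mu>"
      "e (Inl k1) = join_vec (vec ?c) (vec ?c)"
    by blast
  have "join_vec (vec ?c) (vec ?c) $ t = vec ?c $ t" for t :: "'a + 'b"
    by (cases t) auto
  then have const: "e (Inl k1) = vec ?c"
    by (simp add: e(2) vec_eq_iff)
  have c_nonzero: "?c \<noteq> 0"
    using assms(3,4) by (simp add: add_nonneg_eq_0_iff)
  have "biharmonic_index (graph_join G1 G2) =
      real CARD('a + 'b) * (\<Sum>i\<in>UNIV - {Inl k1}. 1 / (\<mu> i)\<^sup>2)"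
    by (rule biharmonic_index_eigenbasis[OF e(1) const c_nonzero]) (simp add: \<mu>_def)
  \<comment> \<open>The zero eigenvalue at \<open>Inl k1\<close> can be put back because its term is
    \<open>1 / 0 = 0\<close>; the full sum then splits over the two factors.\<close>
  also have "(\<Sum>i\<in>UNIV - {Inl k1}. 1 / (\<mu> i)\<^sup>2) = (\<Sum>i\<in>UNIV. 1 / (\<mu> i)\<^sup>2)"
    by (simp add: sum.remove[of UNIV "Inl k1"] \<mu>_def)
  \<comment> \<open>The slot \<open>k2\<close> of the second factor supplies the isolated term with
    eigenvalue \<open>n1 + n2\<close>.\<close>
  also have "\<dots> = (\<Sum>i\<in>UNIV - {k1}. 1 / (\<mu>1 i + real n2)\<^sup>2) +
      (1 / (real n1 + real n2)\<^sup>2 + (\<Sum>j\<in>UNIV - {k2}. 1 / (\<mu>2 j + real n1)\<^sup>2))"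
    by (simp add: sum_UNIV_Plus \<mu>_def sum.remove[of UNIV k1] sum.remove[of UNIV k2])
  also have "(\<Sum>i\<in>UNIV - {k1}. 1 / (\<mu>1 i + real n2)\<^sup>2) =
      (\<Sum>i=2..n1. 1 / (laplacian_eigenvalue G1 i + real n2)\<^sup>2)"
    unfolding assms(3) by (rule sum_laplacian_eigenvalue[OF 1(1,3,4), symmetric])
  also have "(\<Sum>j\<in>UNIV - {k2}. 1 / (\<mu>2 j + real n1)\<^sup>2) =
      (\<Sum>j=2..n2. 1 / (laplacian_eigenvalue G2 j + real n1)\<^sup>2)"
    unfolding assms(4) by (rule sum_laplacian_eigenvalue[OF 2(1,3,4), symmetric])
  also have "real CARD('a + 'b) = real n1 + real n2"
    using assms(3,4) by simp
  finally show ?thesis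
    by (simp add: add_ac)
qed

end
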